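(* Let $n\ge 1$ and $m$ be integers with $n+2\le m\le \frac12(n+1)(n+2)$, and let $\boldsymbol{x}_1,\dots,\boldsymbol{x}_m\in\mathbb{R}^n$ be interpolation points whose KKT matrix $\boldsymbol{W}=\boldsymbol{W}(\boldsymbol{x}_1,\dots,\boldsymbol{x}_m)$ is invertible. Assume that every interpolation point $\boldsymbol{x}_i$ is updated to $\hat{\boldsymbol{x}}_i=\boldsymbol{x}_i+\alpha_i\boldsymbol{d}$ ($i=1,\dots,m$), where $\boldsymbol{d}\in\mathbb{R}^n$ is a direction vector and $\alpha_1,\dots,\alpha_m\in\mathbb{R}$ are scalars. Let $t\in\{1,\dots,n\}$. If $\boldsymbol{d}=\boldsymbol{e}_t$ and $\alpha_i=-2\boldsymbol{x}_i^{(t)}$ for all $i=1,\dots,m$, then the geometry sub-matrix is unchanged, i.e. $\boldsymbol{A}(\hat{\boldsymbol{x}}_1,\dots,\hat{\boldsymbol{x}}_m)=\boldsymbol{A}(\boldsymbol{x}_1,\dots,\boldsymbol{x}_m)$, and the overall perturbation of the KKT matrix, $\Delta\boldsymbol{W}=\boldsymbol{W}(\hat{\boldsymbol{x}}_1,\dots,\hat{\boldsymbol{x}}_m)-\boldsymbol{W}(\boldsymbol{x}_1,\dots,\boldsymbol{x}_m)$, has rank exactly $2$.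
   Context: For points $\boldsymbol{x}_1,\dots,\boldsymbol{x}_m\in\mathbb{R}^n$, the geometry sub-matrix $\boldsymbol{A}=\boldsymbol{A}(\boldsymbol{x}_1,\dots,\boldsymbol{x}_m)\in\mathbb{R}^{m\times m}$ has entries $\boldsymbol{A}_{ij}=\frac12(\boldsymbol{x}_i^\top\boldsymbol{x}_j)^2$. The coordinate matrix $\boldsymbol{X}=\boldsymbol{X}(\boldsymbol{x}_1,\dots,\boldsymbol{x}_m)\in\mathbb{R}^{(n+1)\times m}$ is the matrix whose $i$-th column is $\begin{pmatrix}1\\ \boldsymbol{x}_i\end{pmatrix}$; thus its first row is all ones and its $(t+1)$-th row consists of the $t$-th coordinates of the points. The KKT matrix (arising from least Frobenius norm updating quadratic interpolation) is the symmetric matrix $$\boldsymbol{W}=\boldsymbol{W}(\boldsymbol{x}_1,\dots,\boldsymbol{x}_m)=\begin{pmatrix}\boldsymbol{A} & \boldsymbol{X}^\top\\ \boldsymbol{X} & \boldsymbol{0}\end{pmatrix}\in\mathbb{R}^{(m+n+1)\times(m+n+1)},$$ where $\boldsymbol{0}$ is the $(n+1)\times(n+1)$ zero matrix. Here $\boldsymbol{e}_t$ is the $t$-th standard basis vector of $\mathbb{R}^n$ and $\boldsymbol{x}_i^{(t)}$ is the $t$-th coordinate of $\boldsymbol{x}_i$. *)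

theory Defs
  imports "HOL-Analysis.Analysis"
begin

definition geometry_matrix :: "('m::finite \<Rightarrow> real ^ 'n) \<Rightarrow> real ^ 'm ^ 'm" where
  "geometry_matrix x = (\<chi> i j. (x i \<bullet> x j)\<^sup>2 / 2)"

text \<open>The row index \<open>Inl _\<close> (of the one-element type \<open>1\<close>) is the all-ones row;
  \<open>Inr t\<close> is the row of \<open>t\<close>-th coordinates.\<close>

definition coordinate_matrix :: "('m::finite \<Rightarrow> real ^ 'n) \<Rightarrow> real ^ 'm ^ (1 + 'n)" where
  "coordinate_matrix x = (\<chi> k i. case k of Inl _ \<Rightarrow> 1 | Inr t \<Rightarrow> x i $ t)"

definition block_matrix ::
    "'a ^ 'p ^ 'r \<Rightarrow> 'a ^ 'q ^ 'r \<Rightarrow> 'a ^ 'p ^ 's \<Rightarrow> 'a ^ 'q ^ 's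
      \<Rightarrow> 'a ^ ('p::finite + 'q::finite) ^ ('r::finite + 's::finite)" where
  "block_matrix A B C D = (\<chi> k l.
     case k of
       Inl i \<Rightarrow> (case l of Inl j \<Rightarrow> A $ i $ j | Inr j \<Rightarrow> B $ i $ j)
     | Inr i \<Rightarrow> (case l of Inl j \<Rightarrow> C $ i $ j | Inr j \<Rightarrow> D $ i $ j))"

definition KKT_matrix ::
    "('m::finite \<Rightarrow> real ^ 'n) \<Rightarrow> real ^ ('m + (1 + 'n)) ^ ('m + (1 + 'n))" where
  "KKT_matrix x =
     block_matrix (geometry_matrix x) (transpose (coordinate_matrix x)) (coordinate_matrix x) 0"

end

theory Submission
  imports Defs
begin

text \<open>
  With \<open>d = axis t 1\<close> and \<open>\<alpha> i = - 2 * x i $ t\<close> every point is reflected in the hyperplane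
  orthogonal to \<open>d\<close>. A reflection is an isometry, so all inner products, and with them the
  geometry sub-matrix, stay the same. In the KKT matrix only the row and the column belonging to
  the \<open>t\<close>-th coordinate change. The change is therefore \<open>u v\<^sup>T + v u\<^sup>T\<close>, where \<open>u\<close> is the basis
  vector of that row and \<open>v\<close> lists the numbers \<open>- 2 * x i $ t\<close> in the positions of the points and
  is zero elsewhere. As \<open>u\<close> and \<open>v\<close> are orthogonal, the image of this matrix is the plane spanned
  by \<open>u\<close> and \<open>v\<close> as soon as \<open>v\<close> is nonzero (\<open>rank_symmetric_outer_product\<close>). Invertibility
  excludes \<open>v = 0\<close>, since otherwise the KKT matrix would have a zero column
  (\<open>invertible_KKT_matrix_coordinate_nonzero\<close>).
\<close>

text \<open>Multiplying by \<open>x\<close> gives \<open>(v \<bullet> x) u + (u \<bullet> x) v\<close>. The image thus lies in the span of \<open>u\<close> and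
  \<open>v\<close>, and by orthogonality \<open>v\<close> is mapped to a nonzero multiple of \<open>u\<close> and vice versa.\<close>

lemma rank_symmetric_outer_product:
  fixes u v :: "real ^ 'k"
  assumes "u \<bullet> v = 0" "u \<noteq> 0" "v \<noteq> 0"
  shows "rank (\<chi> i j. u $ i * v $ j + v $ i * u $ j) = 2"
proof -
  let ?M = "(\<chi> i j. u $ i * v $ j + v $ i * u $ j) :: real ^ 'k ^ 'k"
  have mult: "?M *v x = (v \<bullet> x) *\<^sub>R u + (u \<bullet> x) *\<^sub>R v" for x
    by (simp add: vec_eq_iff matrix_vector_mult_def inner_vec_def algebra_simps
        sum.distrib sum_distrib_left)
  have range: "range ((*v) ?M) = span {u, v}"
  proof
    show "range ((*v) ?M) \<subseteq> span {u, v}"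
      by (auto simp: mult intro!: span_add span_scale intro: span_base)
    have preimages: "u = ?M *v ((1 / (v \<bullet> v)) *\<^sub>R v)"
      "v = ?M *v ((1 / (u \<bullet> u)) *\<^sub>R u)"
      using assms by (simp_all add: mult inner_commute)
    have "{u, v} \<subseteq> range ((*v) ?M)"
      using range_eqI[where f = "(*v) ?M", OF preimages(1)]
        range_eqI[where f = "(*v) ?M", OF preimages(2)] by blast
    moreover have "subspace (range ((*v) ?M))"
      by (intro linear_subspace_image matrix_vector_mul_linear subspace_UNIV)
    ultimately show "span {u, v} \<subseteq> range ((*v) ?M)"
      by (rule span_minimal)
  qed
  have "u \<noteq> v"
    using assms by auto
  moreover have "independent {u, v}"
    using assms by (intro pairwise_orthogonal_independent)
      (auto simp: pairwise_def orthogonal_def inner_commute)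
  ultimately have "dim {u, v} = 2"
    by (simp add: dim_eq_card_independent)
  then show ?thesis
    by (simp add: rank_dim_range range)
qed

lemma inner_reflect_axis:
  fixes x y :: "real ^ 'n"
  shows "(x + (- 2 * x $ t) *\<^sub>R axis t 1) \<bullet> (y + (- 2 * y $ t) *\<^sub>R axis t 1) = x \<bullet> y"
  by (simp add: inner_diff_left inner_diff_right inner_axis inner_axis')

text \<open>The column of the KKT matrix at the \<open>t\<close>-th coordinate consists of the numbers \<open>x i $ t\<close>
  and zeros, and an invertible matrix has no zero column.\<close>

lemma invertible_KKT_matrix_coordinate_nonzero:
  fixes x :: "'m::finite \<Rightarrow> real ^ 'n"
  assumes "invertible (KKT_matrix x)"
  shows "\<exists>i. x i $ t \<noteq> 0"
proof (rule ccontr)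
  let ?e = "axis (Inr (Inr t)) 1 :: real ^ ('m + (1 + 'n))"
  assume "\<not> (\<exists>i. x i $ t \<noteq> 0)"
  then have "column (Inr (Inr t)) (KKT_matrix x) = 0"
    by (auto simp: vec_eq_iff column_def KKT_matrix_def block_matrix_def transpose_def
        coordinate_matrix_def split: sum.split)
  then have "KKT_matrix x *v ?e = 0"
    by (simp add: matrix_vector_mult_basis)
  then have "?e = 0"
    using assms by (metis invertible_left_inverse matrix_left_invertible_ker)
  then show False
    by simp
qed

theorem theorem1:
  fixes x xhat :: "'m::finite \<Rightarrow> real ^ 'n"
    and \<alpha> :: "'m \<Rightarrow> real"
    and d :: "real ^ 'n"
    and t :: 'n
  assumes "CARD('n) \<ge> 1"
    and "CARD('n) + 2 \<le> CARD('m)"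
    and "real CARD('m) \<le> (real CARD('n) + 1) * (real CARD('n) + 2) / 2"
    and "invertible (KKT_matrix x)"
    and "\<And>i. xhat i = x i + \<alpha> i *\<^sub>R d"
    and "d = axis t 1"
    and "\<And>i. \<alpha> i = - 2 * x i $ t"
  shows "geometry_matrix xhat = geometry_matrix x \<and>
         rank (KKT_matrix xhat - KKT_matrix x) = 2"
proof
  have xhat: "xhat i = x i + (- 2 * x i $ t) *\<^sub>R axis t 1" for i
    using assms(5-7) by simp
  show geometry: "geometry_matrix xhat = geometry_matrix x"
    unfolding geometry_matrix_def xhat inner_reflect_axis ..
  define u :: "real ^ ('m + (1 + 'n))" where "u = axis (Inr (Inr t)) 1"
  define v :: "real ^ ('m + (1 + 'n))" where
    "v = (\<chi> k. case k of Inl i \<Rightarrow> - 2 * x i $ t | Inr _ \<Rightarrow> 0)"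
  have "KKT_matrix xhat - KKT_matrix x = (\<chi> k l. u $ k * v $ l + v $ k * u $ l)"
    unfolding KKT_matrix_def geometry
    by (auto simp: vec_eq_iff block_matrix_def transpose_def coordinate_matrix_def
        u_def v_def axis_def xhat split: sum.split)
  moreover have "u \<bullet> v = 0" "u \<noteq> 0"
    by (simp_all add: u_def v_def inner_axis')
  moreover have "v \<noteq> 0"
  proof -
    obtain i where "x i $ t \<noteq> 0"
      using invertible_KKT_matrix_coordinate_nonzero[OF assms(4)] by blast
    then have "v $ Inl i \<noteq> 0"
      by (simp add: v_def)
    then show ?thesis
      by auto
  qed
  ultimately show "rank (KKT_matrix xhat - KKT_matrix x) = 2"
    by (simp add: rank_symmetric_outer_product)
qed

end
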